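(* Let $(R,\alpha,i):(\mathcal O_{\mathcal C},\mathcal C,\mathbf 2_{\mathcal C},\iota_{\mathcal C})\to(\mathcal O_{\mathcal D},\mathcal D,\mathbf 2_{\mathcal D},\iota_{\mathcal D})$ be a PFC-functor between PFC-categories which is a right PFC-adjoint. If $(\mathcal O_{\mathcal C},\mathcal C,\mathbf 2_{\mathcal C},\iota_{\mathcal C})$ is an SFC-category, then so is $(\mathcal O_{\mathcal D},\mathcal D,\mathbf 2_{\mathcal D},\iota_{\mathcal D})$, and $(R,\alpha,i)$ is an SFC-functor.
   Context: $\mathbf{Frm}$ is the category of frames and frame homomorphisms, $\mathbf 2=\{0<1\}$, $\mathbf{Top}$ the category of topological spaces, $\mathbb S$ the Sierpinski space ($\{0,1\}$ with opens $\emptyset,\{1\},\{0,1\}$); $|\cdot|$ denotes underlying sets and functions. Lifts. Let $U:\mathcal A\to\mathcal B$ be a faithful functor. A morphism $f:U(A)\to U(A')$ lifts if $f=U(p)$ for a (unique) $p$, its lift. A cartesian lift w.r.t. $U$ of a family $\{f_i:X\to U(C)\}$ is a pair $(\overline X,\theta)$, $\overline X\in\mathcal A$, $\theta:U(\overline X)\to X$ an isomorphism, such that for every $D$ a morphism $h:U(D)\to U(\overline X)$ lifts iff every $f_i\theta h$ lifts. A PFC-category is a quadruple $(\mathcal O_{\mathcal C},\mathcal C,\mathbf 2_{\mathcal C},\iota_{\mathcal C})$ with $\mathcal O_{\mathcal C}:\mathcal C\to\mathbf{Frm}$ faithful, $\mathbf 2_{\mathcal C}\in\mathcal C$, $\iota_{\mathcal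 C}:\mathcal O_{\mathcal C}(\mathbf 2_{\mathcal C})\to\mathbf 2$ an isomorphism. $\mathbf{Top}_{\mathcal C}$ is the full subcategory of $\mathbf{Top}$ of spaces $X$ for which the family $\{|\iota_{\mathcal C}^{-1}|\circ\chi_x:\mathbf{Top}(X,\mathbb S)\to|\mathcal O_{\mathcal C}(\mathbf 2_{\mathcal C})|\mid x\in X\}$, $\chi_x(g)=g(x)$, has a cartesian lift $(\Omega_{\mathcal C}X,\theta_{\mathcal C,X})$ w.r.t. $|\mathcal O_{\mathcal C}(-)|:\mathcal C\to\mathbf{Set}$. $\mathsf{pt}_{\mathcal C}(C)$ is the set $\mathcal C(C,\mathbf 2_{\mathcal C})$ with opens $\{f\mid\iota_{\mathcal C}(\mathcal O_{\mathcal C}f(a))=1\}$, $a\in\mathcal O_{\mathcal C}(C)$. It is an SFC-category if $\mathbb S\in\mathbf{Top}_{\mathcal C}$ and $\mathsf{pt}_{\mathcal C}(C)\in\mathbf{Top}_{\mathcal C}$ for all $C\in\mathcal C$. A PFC-functor $(H,\alpha,i):(\mathcal O_{\mathcal C},\mathcal C,\mathbf 2_{\mathcal C},\iota_{\mathcal C})\to(\mathcal O_{\mathcal D},\mathcal D,\mathbf 2_{\mathcal D},\iota_{\mathcal D})$ consists of a functor $H:\mathcal C\to\mathcal D$, a natural isomorphism $\alpha:\mathcal O_{\mathcal D}H\to\mathcal O_{\mathcal C}$ and an isomorphism $i:H(\mathbf 2_{\mathcal C})\to\mathbf 2_{\mathcal D}$ with $\iota_{\mathcal D}\circ\mathcal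 O_{\mathcal D}(i)=\iota_{\mathcal C}\circ\alpha_{\mathbf 2_{\mathcal C}}$. An SFC-functor is a PFC-functor between SFC-categories such that (M3): for each $X\in\mathbf{Top}_{\mathcal C}$, $(H\Omega_{\mathcal C}X,\theta_{\mathcal C,X}\circ|\alpha_{\Omega_{\mathcal C}X}|)$ is a cartesian lift w.r.t. $|\mathcal O_{\mathcal D}(-)|$ of the family $\{|\alpha_{\mathbf 2_{\mathcal C}}^{-1}|\circ|\iota_{\mathcal C}^{-1}|\circ\chi_x\mid x\in X\}$ of functions $\mathbf{Top}(X,\mathbb S)\to|\mathcal O_{\mathcal D}H(\mathbf 2_{\mathcal C})|$. $(R,\alpha,i)$ is a right PFC-adjoint if there are a PFC-functor $(L,\lambda,j):(\mathcal O_{\mathcal D},\mathcal D,\mathbf 2_{\mathcal D},\iota_{\mathcal D})\to(\mathcal O_{\mathcal C},\mathcal C,\mathbf 2_{\mathcal C},\iota_{\mathcal C})$ and natural transformations $\eta:\mathrm{id}\to RL$, $\epsilon:LR\to\mathrm{id}$ such that $\mathcal O_{\mathcal C}(\epsilon)=\alpha\circ\lambda_R$, $\lambda\circ\alpha_L\circ\mathcal O_{\mathcal D}(\eta)=\mathrm{id}$, $j\circ L(i)=\epsilon_{\mathbf 2_{\mathcal C}}$ and $i\circ R(j)\circ\eta_{\mathbf 2_{\mathcal D}}=\mathrm{id}$. (This is an adjunction $(L,\lambda,j)\dashv(R,\alpha,i)$ in the locally preordered 2-category of PFC-categories; the triangle identities hold automatically by faithfulness.) *)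

theory Defs
  imports "HOL-Algebra.Complete_Lattice" "HOL-Analysis.Abstract_Topology"
begin

section \<open>Categories, functors, natural transformations\<close>

record ('o, 'm) cat =
  Obj :: "'o set"
  Arr :: "'m set"
  Dom :: "'m \<Rightarrow> 'o"
  Cod :: "'m \<Rightarrow> 'o"
  Id :: "'o \<Rightarrow> 'm"
  Comp :: "'m \<Rightarrow> 'm \<Rightarrow> 'm" (infixl \<open>\<cdot>\<index>\<close> 70)

definition homset :: "('o, 'm, 'z) cat_scheme \<Rightarrow> 'o \<Rightarrow> 'o \<Rightarrow> 'm set" where
  "homset C a b = {f \<in> Arr C. Dom C f = a \<and> Cod C f = b}"

locale category =
  fixes C :: "('o, 'm) cat" (structure)
  assumes Dom_Obj: "f \<in> Arr C \<Longrightarrow> Dom C f \<in> Obj C"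
    and Cod_Obj: "f \<in> Arr C \<Longrightarrow> Cod C f \<in> Obj C"
    and Id_hom: "a \<in> Obj C \<Longrightarrow> Id C a \<in> homset C a a"
    and Comp_hom: "\<lbrakk>f \<in> homset C a b; g \<in> homset C b c\<rbrakk> \<Longrightarrow> g \<cdot> f \<in> homset C a c"
    and Id_right: "f \<in> homset C a b \<Longrightarrow> f \<cdot> Id C a = f"
    and Id_left: "f \<in> homset C a b \<Longrightarrow> Id C b \<cdot> f = f"
    and Comp_assoc: "\<lbrakk>f \<in> homset C a b; g \<in> homset C b c; h \<in> homset C c d\<rbrakk>
      \<Longrightarrow> h \<cdot> g \<cdot> f = h \<cdot> (g \<cdot> f)"

definition iso_arrow :: "('o, 'm) cat \<Rightarrow> 'o \<Rightarrow> 'o \<Rightarrow> 'm \<Rightarrow> bool" where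
  "iso_arrow C a b f \<longleftrightarrow> f \<in> homset C a b \<and>
    (\<exists>g \<in> homset C b a. g \<cdot>\<^bsub>C\<^esub> f = Id C a \<and> f \<cdot>\<^bsub>C\<^esub> g = Id C b)"

record ('o, 'm, 'p, 'n) cfunctor =
  fob :: "'o \<Rightarrow> 'p"
  far :: "'m \<Rightarrow> 'n"

locale is_functor = source: category C + target: category D
  for C :: "('o, 'm) cat" and D :: "('p, 'n) cat" +
  fixes F :: "('o, 'm, 'p, 'n) cfunctor"
  assumes fob_Obj: "a \<in> Obj C \<Longrightarrow> fob F a \<in> Obj D"
    and far_hom: "f \<in> homset C a b \<Longrightarrow> far F f \<in> homset D (fob F a) (fob F b)"
    and far_Id: "a \<in> Obj C \<Longrightarrow> far F (Id C a) = Id D (fob F a)"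
    and far_Comp: "\<lbrakk>f \<in> homset C a b; g \<in> homset C b c\<rbrakk>
      \<Longrightarrow> far F (g \<cdot>\<^bsub>C\<^esub> f) = far F g \<cdot>\<^bsub>D\<^esub> far F f"

definition faithful :: "('o, 'm) cat \<Rightarrow> ('o, 'm, 'p, 'n) cfunctor \<Rightarrow> bool" where
  "faithful C F \<longleftrightarrow> (\<forall>a\<in>Obj C. \<forall>b\<in>Obj C. inj_on (far F) (homset C a b))"

definition id_functor :: "('o, 'm, 'o, 'm) cfunctor" where
  "id_functor = \<lparr>fob = (\<lambda>a. a), far = (\<lambda>f. f)\<rparr>"

definition comp_functor ::
  "('p, 'n, 'q, 'k) cfunctor \<Rightarrow> ('o, 'm, 'p, 'n) cfunctor \<Rightarrow> ('o, 'm, 'q, 'k) cfunctor"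
  (infixl \<open>\<circ>\<^sub>F\<close> 55) where
  "G \<circ>\<^sub>F F = \<lparr>fob = fob G \<circ> fob F, far = far G \<circ> far F\<rparr>"

definition nat_trans ::
  "('o, 'm) cat \<Rightarrow> ('p, 'n) cat \<Rightarrow> ('o, 'm, 'p, 'n) cfunctor \<Rightarrow> ('o, 'm, 'p, 'n) cfunctor
    \<Rightarrow> ('o \<Rightarrow> 'n) \<Rightarrow> bool" where
  "nat_trans C D F G \<tau> \<longleftrightarrow>
    (\<forall>a\<in>Obj C. \<tau> a \<in> homset D (fob F a) (fob G a)) \<and>
    (\<forall>f\<in>Arr C. far G f \<cdot>\<^bsub>D\<^esub> \<tau> (Dom C f) = \<tau> (Cod C f) \<cdot>\<^bsub>D\<^esub> far F f)"

section \<open>Frames\<close>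

locale frame = complete_lattice L for L :: "'a gorder" (structure) +
  assumes meet_Sup_distrib: "\<lbrakk>x \<in> carrier L; A \<subseteq> carrier L\<rbrakk>
    \<Longrightarrow> x \<sqinter> (\<Squnion>A) = \<Squnion>((\<lambda>y. x \<sqinter> y) ` A)"

text \<open>
  A frame homomorphism carries its source and target. The two frames may live over different
  types, so that the frame \<open>\<two>\<close> over \<^typ>\<open>bool\<close> and frames over unrelated types can be compared.
  The underlying function is extensional, hence equality of arrows is equality of
  frame homomorphisms.
\<close>

record ('a, 'b) frm_arrow =
  src :: "'a gorder"
  fn :: "'a \<Rightarrow> 'b"
  tgt :: "'b gorder"

definition frm_hom :: "'a gorder \<Rightarrow> 'b gorder \<Rightarrow> ('a, 'b) frm_arrow set" where
  "frm_hom L M = {f. src f = L \<and> tgt f = M \<and> frame L \<and> frame M \<and>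
    fn f \<in> carrier L \<rightarrow>\<^sub>E carrier M \<and>
    fn f \<top>\<^bsub>L\<^esub> = \<top>\<^bsub>M\<^esub> \<and>
    (\<forall>x\<in>carrier L. \<forall>y\<in>carrier L. fn f (x \<sqinter>\<^bsub>L\<^esub> y) = fn f x \<sqinter>\<^bsub>M\<^esub> fn f y) \<and>
    sup_pres L M (fn f)}"

definition frm_id :: "'a gorder \<Rightarrow> ('a, 'a) frm_arrow" where
  "frm_id L = \<lparr>src = L, fn = (\<lambda>x\<in>carrier L. x), tgt = L\<rparr>"

definition frm_comp ::
  "('b, 'c) frm_arrow \<Rightarrow> ('a, 'b) frm_arrow \<Rightarrow> ('a, 'c) frm_arrow" (infixl \<open>\<bullet>\<^sub>f\<close> 70) where
  "g \<bullet>\<^sub>f f = \<lparr>src = src f, fn = compose (carrier (src f)) (fn g) (fn f), tgt = tgt g\<rparr>"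

definition frm_iso :: "'a gorder \<Rightarrow> 'b gorder \<Rightarrow> ('a, 'b) frm_arrow \<Rightarrow> bool" where
  "frm_iso L M f \<longleftrightarrow> f \<in> frm_hom L M \<and>
    (\<exists>g \<in> frm_hom M L. g \<bullet>\<^sub>f f = frm_id L \<and> f \<bullet>\<^sub>f g = frm_id M)"

text \<open>The function underlying the inverse of a frame isomorphism.\<close>

definition inv_fn :: "('a, 'b) frm_arrow \<Rightarrow> 'b \<Rightarrow> 'a" where
  "inv_fn f = inv_into (carrier (src f)) (fn f)"

definition Frm :: "('a gorder, ('a, 'a) frm_arrow) cat" where
  "Frm = \<lparr>Obj = {L. frame L}, Arr = {f. f \<in> frm_hom (src f) (tgt f)}, Dom = src, Cod = tgt,
    Id = frm_id, Comp = frm_comp\<rparr>"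

type_synonym ('o, 'm, 'a) frm_functor = "('o, 'm, 'a gorder, ('a, 'a) frm_arrow) cfunctor"

text \<open>Natural isomorphisms between functors into frames over possibly different types.\<close>

definition frm_nat_iso ::
  "('o, 'm) cat \<Rightarrow> ('o, 'm, 'a) frm_functor \<Rightarrow> ('o, 'm, 'b) frm_functor
    \<Rightarrow> ('o \<Rightarrow> ('a, 'b) frm_arrow) \<Rightarrow> bool" where
  "frm_nat_iso C F G \<alpha> \<longleftrightarrow>
    (\<forall>a\<in>Obj C. frm_iso (fob F a) (fob G a) (\<alpha> a)) \<and>
    (\<forall>f\<in>Arr C. far G f \<bullet>\<^sub>f \<alpha> (Dom C f) = \<alpha> (Cod C f) \<bullet>\<^sub>f far F f)"

definition two_frame :: "bool gorder" (\<open>\<two>\<close>) where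
  "\<two> = \<lparr>carrier = UNIV, eq = (=), le = (\<le>)\<rparr>"

section \<open>Cartesian lifts along set-valued functors\<close>

text \<open>
  \<open>U\<close> and \<open>Um\<close> are the object and arrow parts of a functor from \<open>C\<close> to sets (with
  extensional functions as arrows). A cartesian lift of the family \<open>f i : X \<rightarrow> U c\<close>,
  \<open>i \<in> I\<close>, is an object \<open>W\<close> with a bijection \<open>\<theta> : U W \<rightarrow> X\<close>; the set \<open>X\<close> may have
  another element type than the sets \<open>U a\<close>.
\<close>

definition lifts ::
  "('o, 'm) cat \<Rightarrow> ('m \<Rightarrow> 'u \<Rightarrow> 'u) \<Rightarrow> 'o \<Rightarrow> 'o \<Rightarrow> ('u \<Rightarrow> 'u) \<Rightarrow> bool" where
  "lifts C Um a b h \<longleftrightarrow> (\<exists>p\<in>homset C a b. h = Um p)"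

definition cartesian_lift ::
  "('o, 'm) cat \<Rightarrow> ('o \<Rightarrow> 'u set) \<Rightarrow> ('m \<Rightarrow> 'u \<Rightarrow> 'u) \<Rightarrow> 'x set \<Rightarrow> 'o
    \<Rightarrow> 'i set \<Rightarrow> ('i \<Rightarrow> 'x \<Rightarrow> 'u) \<Rightarrow> 'o \<Rightarrow> ('u \<Rightarrow> 'x) \<Rightarrow> bool" where
  "cartesian_lift C U Um X c I f W \<theta> \<longleftrightarrow>
    W \<in> Obj C \<and> bij_betw \<theta> (U W) X \<and>
    (\<forall>d\<in>Obj C. \<forall>h \<in> U d \<rightarrow>\<^sub>E U W.
      lifts C Um d W h \<longleftrightarrow> (\<forall>i\<in>I. lifts C Um d c (restrict (f i \<circ> \<theta> \<circ> h) (U d))))"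

section \<open>The Sierpinski space\<close>

definition sierpinski :: "bool topology" (\<open>\<S>\<close>) where
  "\<S> = topology (\<lambda>U. U \<in> {{}, {True}, {False, True}})"

text \<open>
  The set of continuous maps from \<open>X\<close> to \<open>\<S>\<close>; extensionality makes maps that agree
  on the underlying set of \<open>X\<close> equal.
\<close>

definition sierpinski_maps :: "'x topology \<Rightarrow> ('x \<Rightarrow> bool) set" where
  "sierpinski_maps X = {g \<in> extensional (topspace X). continuous_map X \<S> g}"

definition chi :: "'x \<Rightarrow> ('x \<Rightarrow> bool) \<Rightarrow> bool" where
  "chi x g = g x"

section \<open>PFC-categories and SFC-categories\<close>

record ('o, 'm, 'a) pfc =
  Opens :: "('o, 'm, 'a) frm_functor"
  Cat :: "('o, 'm) cat"
  Two :: "'o"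
  Iota :: "('a, bool) frm_arrow"

definition pfc_category :: "('o, 'm, 'a) pfc \<Rightarrow> bool" where
  "pfc_category P \<longleftrightarrow>
    is_functor (Cat P) Frm (Opens P) \<and> faithful (Cat P) (Opens P) \<and>
    Two P \<in> Obj (Cat P) \<and> frm_iso (fob (Opens P) (Two P)) \<two> (Iota P)"

definition und :: "('o, 'm, 'a) pfc \<Rightarrow> 'o \<Rightarrow> 'a set" where
  "und P c = carrier (fob (Opens P) c)"

definition undm :: "('o, 'm, 'a) pfc \<Rightarrow> 'm \<Rightarrow> 'a \<Rightarrow> 'a" where
  "undm P f = fn (far (Opens P) f)"

text \<open>\<open>(W, \<theta>)\<close> is an admissible choice of \<open>(\<Omega> X, \<theta> X)\<close>.\<close>

definition is_Omega ::
  "('o, 'm, 'a) pfc \<Rightarrow> 'x topology \<Rightarrow> 'o \<Rightarrow> ('a \<Rightarrow> 'x \<Rightarrow> bool) \<Rightarrow> bool" where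
  "is_Omega P X W \<theta> \<longleftrightarrow>
    cartesian_lift (Cat P) (und P) (undm P) (sierpinski_maps X) (Two P)
      (topspace X) (\<lambda>x. inv_fn (Iota P) \<circ> chi x) W \<theta>"

definition in_Top :: "('o, 'm, 'a) pfc \<Rightarrow> 'x topology \<Rightarrow> bool" where
  "in_Top P X \<longleftrightarrow> (\<exists>W \<theta>. is_Omega P X W \<theta>)"

definition pt_open :: "('o, 'm, 'a) pfc \<Rightarrow> 'o \<Rightarrow> 'a \<Rightarrow> 'm set" where
  "pt_open P c a = {f \<in> homset (Cat P) c (Two P). fn (Iota P) (undm P f a) = True}"

definition pt :: "('o, 'm, 'a) pfc \<Rightarrow> 'o \<Rightarrow> 'm topology" where
  "pt P c = topology (\<lambda>U. \<exists>a\<in>und P c. U = pt_open P c a)"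

definition sfc_category :: "('o, 'm, 'a) pfc \<Rightarrow> bool" where
  "sfc_category P \<longleftrightarrow> pfc_category P \<and> in_Top P \<S> \<and> (\<forall>c\<in>Obj (Cat P). in_Top P (pt P c))"

section \<open>PFC-functors, SFC-functors and right PFC-adjoints\<close>

text \<open>
  The category \<open>P\<close> has frames over \<^typ>\<open>'a\<close>, the category \<open>Q\<close> has frames
  over \<^typ>\<open>'b\<close>; the second component is an isomorphism \<open>Opens Q \<circ> H \<rightarrow> Opens P\<close>.
\<close>

record ('o, 'm, 'a, 'p, 'n, 'b) pfc_fun =
  Fun :: "('o, 'm, 'p, 'n) cfunctor"
  Nat :: "'o \<Rightarrow> ('b, 'a) frm_arrow"
  Cmp :: "'n"

definition pfc_functor ::
  "('o, 'm, 'a) pfc \<Rightarrow> ('p, 'n, 'b) pfc \<Rightarrow> ('o, 'm, 'a, 'p, 'n, 'b) pfc_fun \<Rightarrow> bool" where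
  "pfc_functor P Q H \<longleftrightarrow> pfc_category P \<and> pfc_category Q \<and>
    is_functor (Cat P) (Cat Q) (Fun H) \<and>
    frm_nat_iso (Cat P) (Opens Q \<circ>\<^sub>F Fun H) (Opens P) (Nat H) \<and>
    iso_arrow (Cat Q) (fob (Fun H) (Two P)) (Two Q) (Cmp H) \<and>
    Iota Q \<bullet>\<^sub>f far (Opens Q) (Cmp H) = Iota P \<bullet>\<^sub>f Nat H (Two P)"

text \<open>
  Condition (M3) for the spaces over the type \<^typ>\<open>'x\<close>, for every choice of
  \<open>(\<Omega> X, \<theta> X)\<close>. The type argument is needed since a definition cannot
  quantify over types.
\<close>

definition M3 ::
  "'x itself \<Rightarrow> ('o, 'm, 'a) pfc \<Rightarrow> ('p, 'n, 'b) pfc \<Rightarrow> ('o, 'm, 'a, 'p, 'n, 'b) pfc_fun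
    \<Rightarrow> bool" where
  "M3 (_ :: 'x itself) P Q H \<longleftrightarrow>
    (\<forall>(X :: 'x topology) W \<theta>. is_Omega P X W \<theta> \<longrightarrow>
      cartesian_lift (Cat Q) (und Q) (undm Q) (sierpinski_maps X) (fob (Fun H) (Two P))
        (topspace X) (\<lambda>x. inv_fn (Nat H (Two P)) \<circ> inv_fn (Iota P) \<circ> chi x)
        (fob (Fun H) W) (\<theta> \<circ> fn (Nat H W)))"

definition sfc_functor ::
  "'x itself \<Rightarrow> ('o, 'm, 'a) pfc \<Rightarrow> ('p, 'n, 'b) pfc \<Rightarrow> ('o, 'm, 'a, 'p, 'n, 'b) pfc_fun
    \<Rightarrow> bool" where
  "sfc_functor T P Q H \<longleftrightarrow>
    sfc_category P \<and> sfc_category Q \<and> pfc_functor P Q H \<and> M3 T P Q H"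

definition right_pfc_adjoint ::
  "('o, 'm, 'a) pfc \<Rightarrow> ('p, 'n, 'b) pfc \<Rightarrow> ('o, 'm, 'a, 'p, 'n, 'b) pfc_fun \<Rightarrow> bool" where
  "right_pfc_adjoint P Q R \<longleftrightarrow>
    (\<exists>(L :: ('p, 'n, 'b, 'o, 'm, 'a) pfc_fun) \<eta> \<epsilon>.
      pfc_functor Q P L \<and>
      nat_trans (Cat Q) (Cat Q) id_functor (Fun R \<circ>\<^sub>F Fun L) \<eta> \<and>
      nat_trans (Cat P) (Cat P) (Fun L \<circ>\<^sub>F Fun R) id_functor \<epsilon> \<and>
      (\<forall>c\<in>Obj (Cat P). far (Opens P) (\<epsilon> c) = Nat R c \<bullet>\<^sub>f Nat L (fob (Fun R) c)) \<and>
      (\<forall>d\<in>Obj (Cat Q). Nat L d \<bullet>\<^sub>f Nat R (fob (Fun L) d) \<bullet>\<^sub>f far (Opens Q) (\<eta> d)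
        = frm_id (fob (Opens Q) d)) \<and>
      Cmp L \<cdot>\<^bsub>Cat P\<^esub> far (Fun L) (Cmp R) = \<epsilon> (Two P) \<and>
      Cmp R \<cdot>\<^bsub>Cat Q\<^esub> far (Fun R) (Cmp L) \<cdot>\<^bsub>Cat Q\<^esub> \<eta> (Two Q) = Id (Cat Q) (Two Q))"

section \<open>Well-definedness\<close>

lemma frm_id_hom: "frame L \<Longrightarrow> frm_id L \<in> frm_hom L L"
proof -
  assume L: "frame L"
  interpret frame L by fact
  have img: "(\<lambda>x\<in>carrier L. x) ` A = A" if "A \<subseteq> carrier L" for A
    using image_cong[of A A "\<lambda>x\<in>carrier L. x" "\<lambda>x. x"] that by auto
  have *: "(\<lambda>x\<in>carrier L. x) (\<Squnion>\<^bsub>L\<^esub>A) = \<Squnion>\<^bsub>L\<^esub>((\<lambda>x\<in>carrier L. x) ` A)"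
    if "A \<subseteq> carrier L" for A
    unfolding img[OF that] by (rule restrict_apply'[OF sup_closed[OF that]])
  have "sup_pres L L (\<lambda>x\<in>carrier L. x)"
    unfolding sup_pres_def using complete_lattice_axioms * by blast
  then show ?thesis
    using L by (auto simp: frm_hom_def frm_id_def)
qed

lemma frm_comp_hom: "\<lbrakk>f \<in> frm_hom L M; g \<in> frm_hom M N\<rbrakk> \<Longrightarrow> g \<bullet>\<^sub>f f \<in> frm_hom L N"
proof -
  assume f: "f \<in> frm_hom L M" and g: "g \<in> frm_hom M N"
  interpret L: frame L using f by (simp add: frm_hom_def)
  have fc: "fn f x \<in> carrier M" if "x \<in> carrier L" for x
    using f that by (auto simp: frm_hom_def)
  have comp: "compose (carrier L) (fn g) (fn f) x = fn g (fn f x)" if "x \<in> carrier L" for x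
    using that by (rule compose_eq)
  have "compose (carrier L) (fn g) (fn f) (\<Squnion>\<^bsub>L\<^esub>A)
    = \<Squnion>\<^bsub>N\<^esub>(compose (carrier L) (fn g) (fn f) ` A)" if A: "A \<subseteq> carrier L" for A
  proof -
    have "compose (carrier L) (fn g) (fn f) ` A = fn g ` fn f ` A"
      unfolding image_image using comp A by (intro image_cong) auto
    moreover have "fn f ` A \<subseteq> carrier M" using fc A by blast
    ultimately show ?thesis
      using f g A comp[OF L.sup_closed[OF A]] by (simp add: frm_hom_def sup_pres_def)
  qed
  then have "sup_pres L N (compose (carrier L) (fn g) (fn f))"
    using f g by (simp add: frm_hom_def sup_pres_def)
  moreover have "compose (carrier L) (fn g) (fn f) \<in> carrier L \<rightarrow>\<^sub>E carrier N"
    using f g by (auto simp: frm_hom_def compose_def)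
  moreover have "compose (carrier L) (fn g) (fn f) (x \<sqinter>\<^bsub>L\<^esub> y)
    = compose (carrier L) (fn g) (fn f) x \<sqinter>\<^bsub>N\<^esub> compose (carrier L) (fn g) (fn f) y"
    if "x \<in> carrier L" "y \<in> carrier L" for x y
    using f g that fc by (simp add: frm_hom_def comp)
  moreover have "compose (carrier L) (fn g) (fn f) \<top>\<^bsub>L\<^esub> = \<top>\<^bsub>N\<^esub>"
    using f g by (simp add: frm_hom_def comp)
  ultimately show ?thesis
    using f g by (simp add: frm_hom_def frm_comp_def)
qed

lemma category_Frm: "category Frm"
proof
  fix f g h :: "('a, 'a) frm_arrow" and a b c d :: "'a gorder"
  have hs: "homset Frm a b = frm_hom a b" for a b :: "'a gorder"
    by (auto simp: homset_def Frm_def frm_hom_def)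
  have [simp]: "Id Frm = frm_id" "Comp Frm = frm_comp" "Obj Frm = {L. frame L}"
    by (simp_all add: Frm_def)
  show "f \<in> Arr Frm \<Longrightarrow> Dom Frm f \<in> Obj Frm" "f \<in> Arr Frm \<Longrightarrow> Cod Frm f \<in> Obj Frm"
    by (auto simp: Frm_def frm_hom_def)
  show "a \<in> Obj Frm \<Longrightarrow> Id Frm a \<in> homset Frm a a"
    by (simp add: hs frm_id_hom)
  show "\<lbrakk>f \<in> homset Frm a b; g \<in> homset Frm b c\<rbrakk> \<Longrightarrow> g \<cdot>\<^bsub>Frm\<^esub> f \<in> homset Frm a c"
    by (simp add: hs frm_comp_hom)
  show "f \<in> homset Frm a b \<Longrightarrow> f \<cdot>\<^bsub>Frm\<^esub> Id Frm a = f"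
    by (cases f) (auto simp: hs frm_hom_def frm_comp_def frm_id_def compose_def fun_eq_iff
        PiE_def extensional_def)
  show "f \<in> homset Frm a b \<Longrightarrow> Id Frm b \<cdot>\<^bsub>Frm\<^esub> f = f"
    by (cases f) (auto simp: hs frm_hom_def frm_comp_def frm_id_def PiE_iff intro!: Id_compose)
  show "\<lbrakk>f \<in> homset Frm a b; g \<in> homset Frm b c; h \<in> homset Frm c d\<rbrakk>
      \<Longrightarrow> h \<cdot>\<^bsub>Frm\<^esub> g \<cdot>\<^bsub>Frm\<^esub> f = h \<cdot>\<^bsub>Frm\<^esub> (g \<cdot>\<^bsub>Frm\<^esub> f)"
    by (auto simp: hs frm_hom_def frm_comp_def compose_def fun_eq_iff)
qed

lemma two_least: "least \<two> s (Upper \<two> A) \<longleftrightarrow> s = (True \<in> A)"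
proof -
  have "Upper \<two> A = {u. True \<in> A \<longrightarrow> u}"
    unfolding Upper_def two_frame_def by (simp add: le_bool_def set_eq_iff) metis
  then show ?thesis
    by (cases s; cases "True \<in> A") (auto simp: least_def two_frame_def le_bool_def)
qed

lemma two_greatest: "greatest \<two> s (Lower \<two> A) \<longleftrightarrow> s = (False \<notin> A)"
proof -
  have "Lower \<two> A = {l. False \<in> A \<longrightarrow> \<not> l}"
    unfolding Lower_def two_frame_def by (simp add: le_bool_def set_eq_iff) metis
  then show ?thesis
    by (cases s; cases "False \<in> A") (auto simp: greatest_def two_frame_def le_bool_def)
qed

lemma two_Sup: "\<Squnion>\<^bsub>\<two>\<^esub>A = (True \<in> A)"
  by (simp add: Lattice.sup_def two_least)

lemma two_meet: "x \<sqinter>\<^bsub>\<two>\<^esub> y = (x \<and> y)"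
  by (auto simp: Lattice.meet_def Lattice.inf_def two_greatest)

lemma two_top: "\<top>\<^bsub>\<two>\<^esub> = True"
  unfolding Order.top_def
  by (rule some_equality) (auto simp: greatest_def two_frame_def le_bool_def)

lemma frame_two: "frame \<two>"
proof -
  have "complete_lattice \<two>"
  proof
    show "\<exists>s. least \<two> s (Upper \<two> A)" "\<exists>i. greatest \<two> i (Lower \<two> A)" for A
      by (simp_all add: two_least two_greatest)
  qed (auto simp: two_frame_def)
  then show ?thesis
    by (auto simp: frame_def frame_axioms_def two_Sup two_meet)
qed

lemma openin_sierpinski: "openin \<S> U \<longleftrightarrow> U \<in> {{}, {True}, {False, True}}"
proof -
  have char: "(\<lambda>U. U \<in> {{}, {True}, {False, True}}) = (\<lambda>U. False \<in> U \<longrightarrow> True \<in> U)"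
  proof
    fix U :: "bool set"
    have "U \<in> Pow {False, True}" by auto
    then have "U = {} \<or> U = {True} \<or> U = {False} \<or> U = {False, True}"
      unfolding Pow_insert Pow_empty by blast
    then show "U \<in> {{}, {True}, {False, True}} \<longleftrightarrow> (False \<in> U \<longrightarrow> True \<in> U)"
      by (elim disjE) simp_all
  qed
  have "istopology (\<lambda>U. False \<in> U \<longrightarrow> True \<in> U)"
    unfolding istopology_def by blast
  then show ?thesis
    unfolding sierpinski_def char using fun_cong[OF char, of U] by simp
qed

lemma openin_pt:
  assumes P: "pfc_category P" and c: "c \<in> Obj (Cat P)"
  shows "openin (pt P c) U \<longleftrightarrow> (\<exists>a\<in>und P c. U = pt_open P c a)"
proof -
  let ?L = "fob (Opens P) c" and ?T = "fob (Opens P) (Two P)"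
  define e where "e f = Iota P \<bullet>\<^sub>f far (Opens P) f" for f
  interpret is_functor "Cat P" Frm "Opens P" using P by (simp add: pfc_category_def)
  have io: "Iota P \<in> frm_hom ?T \<two>" using P by (simp add: pfc_category_def frm_iso_def)
  have e: "e f \<in> frm_hom ?L \<two>" if "f \<in> homset (Cat P) c (Two P)" for f
    using far_hom[OF that] io unfolding e_def
    by (intro frm_comp_hom) (auto simp: homset_def Frm_def)
  have srce: "src (far (Opens P) f) = ?L" if "f \<in> homset (Cat P) c (Two P)" for f
    using far_hom[OF that] by (auto simp: homset_def Frm_def)
  have po: "pt_open P c a = {f \<in> homset (Cat P) c (Two P). fn (e f) a}" if "a \<in> carrier ?L" for a
    using that srce by (auto simp: pt_open_def undm_def e_def frm_comp_def compose_eq)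
  interpret L: frame ?L using fob_Obj[OF c] by (simp add: Frm_def)
  have "istopology (\<lambda>U. \<exists>a\<in>carrier ?L. U = pt_open P c a)"
    unfolding istopology_def
  proof (intro conjI allI impI)
    fix S T assume "\<exists>a\<in>carrier ?L. S = pt_open P c a" "\<exists>a\<in>carrier ?L. T = pt_open P c a"
    then obtain a b where ab: "a \<in> carrier ?L" "S = pt_open P c a"
      "b \<in> carrier ?L" "T = pt_open P c b" by blast
    have "S \<inter> T = pt_open P c (a \<sqinter>\<^bsub>?L\<^esub> b)"
      using ab e by (auto simp: po frm_hom_def two_meet)
    moreover have "a \<sqinter>\<^bsub>?L\<^esub> b \<in> carrier ?L" using ab by simp
    ultimately show "\<exists>a\<in>carrier ?L. S \<inter> T = pt_open P c a" by (rule bexI)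
  next
    fix K assume K: "\<forall>S\<in>K. \<exists>a\<in>carrier ?L. S = pt_open P c a"
    define A where "A = {a \<in> carrier ?L. pt_open P c a \<in> K}"
    have A: "A \<subseteq> carrier ?L" by (auto simp: A_def)
    have "\<Union>K = (\<Union>a\<in>A. pt_open P c a)"
    proof
      show "\<Union>K \<subseteq> (\<Union>a\<in>A. pt_open P c a)"
      proof (rule Union_least)
        fix S assume "S \<in> K"
        then obtain a where a: "a \<in> carrier ?L" "S = pt_open P c a" using K by blast
        then have "a \<in> A" using \<open>S \<in> K\<close> by (simp add: A_def)
        then show "S \<subseteq> (\<Union>a\<in>A. pt_open P c a)" unfolding a(2) by (rule UN_upper)
      qed
      show "(\<Union>a\<in>A. pt_open P c a) \<subseteq> \<Union>K"
        by (rule UN_least) (simp add: A_def Union_upper)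
    qed
    also have "\<dots> = {f \<in> homset (Cat P) c (Two P). \<exists>a\<in>A. fn (e f) a}"
    proof -
      have "pt_open P c a = {f \<in> homset (Cat P) c (Two P). fn (e f) a}" if "a \<in> A" for a
        using po subsetD[OF A that] by blast
      then show ?thesis by blast
    qed
    also have "\<dots> = pt_open P c (\<Squnion>\<^bsub>?L\<^esub>A)"
    proof -
      have "fn (e f) (\<Squnion>\<^bsub>?L\<^esub>A) \<longleftrightarrow> (\<exists>a\<in>A. fn (e f) a)"
        if "f \<in> homset (Cat P) c (Two P)" for f
      proof -
        have "fn (e f) (\<Squnion>\<^bsub>?L\<^esub>A) = \<Squnion>\<^bsub>\<two>\<^esub>(fn (e f) ` A)"
          using e[OF that] A by (simp add: frm_hom_def sup_pres_def)
        then show ?thesis by (auto simp: two_Sup)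
      qed
      then show ?thesis using po[OF L.sup_closed[OF A]] by blast
    qed
    finally show "\<exists>a\<in>carrier ?L. \<Union>K = pt_open P c a"
      by (rule bexI) (rule L.sup_closed[OF A])
  qed
  then show ?thesis by (simp add: pt_def und_def)
qed

lemma topspace_pt:
  assumes P: "pfc_category P" and c: "c \<in> Obj (Cat P)"
  shows "topspace (pt P c) = homset (Cat P) c (Two P)"
proof -
  interpret is_functor "Cat P" Frm "Opens P" using P by (simp add: pfc_category_def)
  interpret L: frame "fob (Opens P) c" using fob_Obj[OF c] by (simp add: Frm_def)
  have "fn (Iota P) (undm P f \<top>\<^bsub>fob (Opens P) c\<^esub>) = True"
    if "f \<in> homset (Cat P) c (Two P)" for f
  proof -
    have "far (Opens P) f \<in> frm_hom (fob (Opens P) c) (fob (Opens P) (Two P))"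
      using far_hom[OF that] by (auto simp: homset_def Frm_def)
    moreover have "Iota P \<in> frm_hom (fob (Opens P) (Two P)) \<two>"
      using P by (simp add: pfc_category_def frm_iso_def)
    ultimately show ?thesis by (simp add: frm_hom_def undm_def two_top)
  qed
  then have "homset (Cat P) c (Two P) = pt_open P c \<top>\<^bsub>fob (Opens P) c\<^esub>"
    by (auto simp: pt_open_def)
  then have "openin (pt P c) (homset (Cat P) c (Two P))"
    unfolding openin_pt[OF P c] und_def by (metis L.top_closed)
  moreover have "topspace (pt P c) \<subseteq> homset (Cat P) c (Two P)"
    using openin_pt[OF P c, of "topspace (pt P c)"] by (auto simp: pt_open_def)
  ultimately show ?thesis by (meson openin_subset subset_antisym)
qed

end

theory Submission
  imports Defs
begin

text \<open>
  Write \<open>(L, \<lambda>, j) \<stileturn> (R, \<alpha>, i)\<close> for the adjunction. The argument rests on the observation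
  that transposition can be tested on underlying functions: since \<open>\<O> \<epsilon> = \<alpha> \<circ> \<lambda>\<close> and
  \<open>\<lambda> \<circ> \<alpha> \<circ> \<O> \<eta> = id\<close>, a function \<open>h : |d| \<rightarrow> |R c|\<close> lifts to an arrow \<open>d \<rightarrow> R c\<close> iff
  \<open>\<alpha> \<circ> h \<circ> \<lambda> : |L d| \<rightarrow> |c|\<close> lifts to an arrow \<open>L d \<rightarrow> c\<close> (\<open>lifts_transpose\<close>).
  Applying this to \<open>\<Omega> X\<close> and to \<open>2\<close> in place of \<open>c\<close>, the test characterising the cartesian lift
  \<open>\<Omega> X\<close> becomes the test saying that \<open>R (\<Omega> X)\<close> is a cartesian lift, which is (M3).

  Composing with the isomorphism \<open>i : R 2 \<rightarrow> 2\<close> turns this cartesian lift into a choice of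
  \<open>\<Omega> X\<close> for the second category, so every space with an \<open>\<Omega>\<close> in the first category, in particular
  the Sierpinski space, also has one in the second. It remains to treat the spaces
  \<open>pt d\<close>: the map \<open>g \<mapsto> j \<circ> L g\<close> is a homeomorphism from \<open>pt d\<close> to \<open>pt (L d)\<close>
  (\<open>pt_homeomorphic\<close>), and having an \<open>\<Omega>\<close> is invariant under homeomorphism
  (\<open>in_Top_homeomorphic\<close>).
\<close>

section \<open>Frame homomorphisms on elements\<close>

lemma homset_Frm: "homset Frm L M = frm_hom L M"
  by (auto simp: homset_def Frm_def frm_hom_def)

lemma frm_hom_fn: "f \<in> frm_hom L M \<Longrightarrow> fn f \<in> carrier L \<rightarrow>\<^sub>E carrier M"
  by (simp add: frm_hom_def)

lemma frm_comp_apply: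
  "\<lbrakk>f \<in> frm_hom L M; x \<in> carrier L\<rbrakk> \<Longrightarrow> fn (g \<bullet>\<^sub>f f) x = fn g (fn f x)"
  by (simp add: frm_comp_def frm_hom_def compose_eq)

lemma frm_iso_bij:
  assumes "frm_iso L M f"
  shows "bij_betw (fn f) (carrier L) (carrier M)"
proof -
  obtain g where f: "f \<in> frm_hom L M" and g: "g \<in> frm_hom M L"
    and gf: "g \<bullet>\<^sub>f f = frm_id L" and fg: "f \<bullet>\<^sub>f g = frm_id M"
    using assms by (auto simp: frm_iso_def)
  have "fn g (fn f x) = x" if "x \<in> carrier L" for x
    using frm_comp_apply[OF f that, of g] that by (simp add: gf frm_id_def)
  moreover have "fn f (fn g y) = y" if "y \<in> carrier M" for y
    using frm_comp_apply[OF g that, of f] that by (simp add: fg frm_id_def)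
  ultimately show ?thesis
    using frm_hom_fn[OF f] frm_hom_fn[OF g]
    by (intro bij_betw_byWitness[where f' = "fn g"]) auto
qed

lemma frm_iso_hom: "frm_iso L M f \<Longrightarrow> f \<in> frm_hom L M"
  by (simp add: frm_iso_def)

lemma inv_fn_eq:
  assumes "frm_iso L M f"
  shows "inv_fn f = inv_into (carrier L) (fn f)"
  using frm_iso_hom[OF assms] by (simp add: inv_fn_def frm_hom_def)

lemma inv_fn_closed:
  assumes "frm_iso L M f" and "y \<in> carrier M"
  shows "inv_fn f y \<in> carrier L"
  using frm_iso_bij[OF assms(1)] assms(2)
  by (auto simp: inv_fn_eq[OF assms(1)] bij_betw_def intro: inv_into_into)

lemma fn_inv_fn:
  assumes "frm_iso L M f" and "y \<in> carrier M"
  shows "fn f (inv_fn f y) = y"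
  using frm_iso_bij[OF assms(1)] assms(2)
  by (auto simp: inv_fn_eq[OF assms(1)] bij_betw_def f_inv_into_f)

lemma carrier_two [simp]: "carrier \<two> = UNIV"
  by (simp add: two_frame_def)

section \<open>Underlying functions in a PFC-category\<close>

locale pfc_cat =
  fixes P :: "('o, 'm, 'a) pfc"
  assumes pfc_category: "pfc_category P"
begin

sublocale is_functor "Cat P" Frm "Opens P"
  using pfc_category by (simp add: pfc_category_def)

lemma Two_Obj: "Two P \<in> Obj (Cat P)"
  using pfc_category by (simp add: pfc_category_def)

lemma Iota_iso: "frm_iso (fob (Opens P) (Two P)) \<two> (Iota P)"
  using pfc_category by (simp add: pfc_category_def)

lemma Iota_inj: "inj_on (fn (Iota P)) (und P (Two P))"
  using frm_iso_bij[OF Iota_iso] by (simp add: und_def bij_betw_def)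

lemma hom_Obj: "f \<in> homset (Cat P) a b \<Longrightarrow> a \<in> Obj (Cat P) \<and> b \<in> Obj (Cat P)"
  using source.Dom_Obj source.Cod_Obj by (auto simp: homset_def)

lemma far_frm_hom:
  "f \<in> homset (Cat P) a b \<Longrightarrow> far (Opens P) f \<in> frm_hom (fob (Opens P) a) (fob (Opens P) b)"
  using far_hom by (simp add: homset_Frm)

lemma undm_PiE: "f \<in> homset (Cat P) a b \<Longrightarrow> undm P f \<in> und P a \<rightarrow>\<^sub>E und P b"
  using frm_hom_fn[OF far_frm_hom] by (simp add: undm_def und_def)

lemma undm_closed: "\<lbrakk>f \<in> homset (Cat P) a b; x \<in> und P a\<rbrakk> \<Longrightarrow> undm P f x \<in> und P b"
  using undm_PiE by blast

lemma undm_extensional: "f \<in> homset (Cat P) a b \<Longrightarrow> undm P f \<in> extensional (und P a)"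
  using undm_PiE by (auto simp: PiE_def)

lemma undm_comp:
  assumes "f \<in> homset (Cat P) a b" and "g \<in> homset (Cat P) b c" and "x \<in> und P a"
  shows "undm P (g \<cdot>\<^bsub>Cat P\<^esub> f) x = undm P g (undm P f x)"
proof -
  have "undm P (g \<cdot>\<^bsub>Cat P\<^esub> f) = fn (far (Opens P) g \<bullet>\<^sub>f far (Opens P) f)"
    using far_Comp[OF assms(1,2)] by (simp add: undm_def Frm_def)
  then show ?thesis
    using frm_comp_apply[OF far_frm_hom[OF assms(1)]] assms(3) by (simp add: und_def undm_def)
qed

lemma undm_Id:
  assumes "a \<in> Obj (Cat P)" and "x \<in> und P a"
  shows "undm P (Id (Cat P) a) x = x"
  using far_Id[OF assms(1)] assms(2) by (simp add: undm_def und_def Frm_def frm_id_def)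

lemma undm_faithful:
  assumes f: "f \<in> homset (Cat P) a b" and g: "g \<in> homset (Cat P) a b"
    and eq: "\<And>x. x \<in> und P a \<Longrightarrow> undm P f x = undm P g x"
  shows "f = g"
proof -
  have "undm P f = undm P g"
    using PiE_ext[OF undm_PiE[OF f] undm_PiE[OF g]] eq by blast
  then have "far (Opens P) f = far (Opens P) g"
    using far_frm_hom[OF f] far_frm_hom[OF g]
    by (intro frm_arrow.equality) (auto simp: frm_hom_def undm_def)
  then show ?thesis
    using pfc_category f g hom_Obj[OF f] by (auto simp: pfc_category_def faithful_def inj_on_def)
qed

lemma lifts_comp_iso:
  assumes k: "iso_arrow (Cat P) b b' k" and h: "h \<in> und P a \<rightarrow>\<^sub>E und P b"
  shows "lifts (Cat P) (undm P) a b h \<longleftrightarrow>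
    lifts (Cat P) (undm P) a b' (restrict (undm P k \<circ> h) (und P a))" (is "?l \<longleftrightarrow> ?r")
proof -
  obtain k' where kh: "k \<in> homset (Cat P) b b'" and k'h: "k' \<in> homset (Cat P) b' b"
    and k'k: "k' \<cdot>\<^bsub>Cat P\<^esub> k = Id (Cat P) b"
    using k by (auto simp: iso_arrow_def)
  show ?thesis
  proof
    assume ?l
    then obtain p where p: "p \<in> homset (Cat P) a b" "h = undm P p" by (auto simp: lifts_def)
    have kp: "k \<cdot>\<^bsub>Cat P\<^esub> p \<in> homset (Cat P) a b'" by (rule source.Comp_hom[OF p(1) kh])
    have "restrict (undm P k \<circ> h) (und P a) = undm P (k \<cdot>\<^bsub>Cat P\<^esub> p)"
      using undm_extensional[OF kp] undm_comp[OF p(1) kh]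
      by (intro extensionalityI[of _ "und P a"]) (auto simp: p(2))
    then show ?r using kp by (auto simp: lifts_def)
  next
    assume ?r
    then obtain q where q: "q \<in> homset (Cat P) a b'"
      "restrict (undm P k \<circ> h) (und P a) = undm P q" by (auto simp: lifts_def)
    have k'q: "k' \<cdot>\<^bsub>Cat P\<^esub> q \<in> homset (Cat P) a b" by (rule source.Comp_hom[OF q(1) k'h])
    have "h x = undm P (k' \<cdot>\<^bsub>Cat P\<^esub> q) x" if x: "x \<in> und P a" for x
    proof -
      have hx: "h x \<in> und P b" using h x by blast
      have "undm P (k' \<cdot>\<^bsub>Cat P\<^esub> q) x = undm P k' (undm P k (h x))"
        using undm_comp[OF q(1) k'h x] x by (simp add: q(2)[symmetric])
      also have "\<dots> = h x"
        using undm_comp[OF kh k'h hx] undm_Id[OF _ hx] hom_Obj[OF kh] by (simp add: k'k)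
      finally show ?thesis by simp
    qed
    then have "h = undm P (k' \<cdot>\<^bsub>Cat P\<^esub> q)"
      using PiE_ext[OF h undm_PiE[OF k'q]] by simp
    then show ?l using k'q by (auto simp: lifts_def)
  qed
qed

end

section \<open>PFC-functors on elements\<close>

locale pfc_fctr = source: pfc_cat P + target: pfc_cat Q
  for P :: "('o, 'm, 'a) pfc" and Q :: "('p, 'n, 'b) pfc" +
  fixes H :: "('o, 'm, 'a, 'p, 'n, 'b) pfc_fun"
  assumes pfc_functor: "pfc_functor P Q H"
begin

sublocale F: is_functor "Cat P" "Cat Q" "Fun H"
  using pfc_functor by (simp add: pfc_functor_def)

lemma Nat_iso:
  "a \<in> Obj (Cat P) \<Longrightarrow> frm_iso (fob (Opens Q) (fob (Fun H) a)) (fob (Opens P) a) (Nat H a)"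
  using pfc_functor by (simp add: pfc_functor_def frm_nat_iso_def comp_functor_def)

lemma Nat_bij: "a \<in> Obj (Cat P) \<Longrightarrow> bij_betw (fn (Nat H a)) (und Q (fob (Fun H) a)) (und P a)"
  using frm_iso_bij[OF Nat_iso] by (simp add: und_def)

lemma Nat_closed:
  "\<lbrakk>a \<in> Obj (Cat P); x \<in> und Q (fob (Fun H) a)\<rbrakk> \<Longrightarrow> fn (Nat H a) x \<in> und P a"
  using Nat_bij by (auto simp: bij_betw_def)

lemma Nat_inj: "a \<in> Obj (Cat P) \<Longrightarrow> inj_on (fn (Nat H a)) (und Q (fob (Fun H) a))"
  using Nat_bij by (simp add: bij_betw_def)

lemma Nat_natural:
  assumes f: "f \<in> homset (Cat P) a b" and x: "x \<in> und Q (fob (Fun H) a)"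
  shows "undm P f (fn (Nat H a) x) = fn (Nat H b) (undm Q (far (Fun H) f) x)"
proof -
  have "far (Opens P) f \<bullet>\<^sub>f Nat H a = Nat H b \<bullet>\<^sub>f far (Opens Q) (far (Fun H) f)"
    using pfc_functor f
    by (auto simp: pfc_functor_def frm_nat_iso_def comp_functor_def homset_def)
  moreover have "fn (far (Opens P) f \<bullet>\<^sub>f Nat H a) x = undm P f (fn (Nat H a) x)"
    using frm_comp_apply[OF frm_iso_hom[OF Nat_iso], of a x "far (Opens P) f"]
      source.hom_Obj[OF f] x
    by (simp add: und_def undm_def)
  moreover have "fn (Nat H b \<bullet>\<^sub>f far (Opens Q) (far (Fun H) f)) x
    = fn (Nat H b) (undm Q (far (Fun H) f) x)"
    using frm_comp_apply[OF target.far_frm_hom[OF F.far_hom[OF f]]] x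
    by (simp add: und_def undm_def)
  ultimately show ?thesis by simp
qed

lemma Cmp_iso: "iso_arrow (Cat Q) (fob (Fun H) (Two P)) (Two Q) (Cmp H)"
  using pfc_functor by (simp add: pfc_functor_def)

lemma Cmp_hom: "Cmp H \<in> homset (Cat Q) (fob (Fun H) (Two P)) (Two Q)"
  using Cmp_iso by (simp add: iso_arrow_def)

lemma Iota_Cmp:
  assumes x: "x \<in> und Q (fob (Fun H) (Two P))"
  shows "fn (Iota Q) (undm Q (Cmp H) x) = fn (Iota P) (fn (Nat H (Two P)) x)"
proof -
  have "Iota Q \<bullet>\<^sub>f far (Opens Q) (Cmp H) = Iota P \<bullet>\<^sub>f Nat H (Two P)"
    using pfc_functor by (simp add: pfc_functor_def)
  moreover have "fn (Iota Q \<bullet>\<^sub>f far (Opens Q) (Cmp H)) x = fn (Iota Q) (undm Q (Cmp H) x)"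
    using frm_comp_apply[OF target.far_frm_hom[OF Cmp_hom]] x by (simp add: und_def undm_def)
  moreover have "fn (Iota P \<bullet>\<^sub>f Nat H (Two P)) x = fn (Iota P) (fn (Nat H (Two P)) x)"
    using frm_comp_apply[OF frm_iso_hom[OF Nat_iso[OF source.Two_Obj]]] x by (simp add: und_def)
  ultimately show ?thesis by simp
qed

text \<open>
  The inverse of \<open>\<iota>\<close> on the target is \<open>\<O> i \<circ> \<alpha>\<inverse> \<circ> \<iota>\<inverse>\<close>; thus \<open>i\<close> carries the family
  of (M3) to the family defining \<open>\<Omega>\<close> in the target.
\<close>

lemma inv_Iota_target:
  "inv_fn (Iota Q) v = undm Q (Cmp H) (inv_fn (Nat H (Two P)) (inv_fn (Iota P) v))"
proof -
  have c: "inv_fn (Iota P) v \<in> und P (Two P)"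
    using inv_fn_closed[OF source.Iota_iso] by (simp add: und_def)
  have n: "inv_fn (Nat H (Two P)) (inv_fn (Iota P) v) \<in> und Q (fob (Fun H) (Two P))"
    using inv_fn_closed[OF Nat_iso[OF source.Two_Obj]] c by (simp add: und_def)
  have "fn (Iota Q) (undm Q (Cmp H) (inv_fn (Nat H (Two P)) (inv_fn (Iota P) v))) = v"
    using Iota_Cmp[OF n] fn_inv_fn[OF Nat_iso[OF source.Two_Obj]] c
      fn_inv_fn[OF source.Iota_iso, of v] by (simp add: und_def)
  moreover have "fn (Iota Q) (inv_fn (Iota Q) v) = v"
    using fn_inv_fn[OF target.Iota_iso, of v] by simp
  ultimately show ?thesis
    using inj_onD[OF target.Iota_inj] inv_fn_closed[OF target.Iota_iso, of v]
      target.undm_closed[OF Cmp_hom n] by (simp add: und_def)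
qed

end

section \<open>Transposition and condition (M3)\<close>

text \<open>
  PFC-functors \<open>L\<close> and \<open>R\<close> with components of a unit \<open>\<eta>\<close> and a counit \<open>\<epsilon>\<close> whose underlying
  frame homomorphisms are determined by the two natural isomorphisms. Naturality of \<open>\<eta>\<close> and
  \<open>\<epsilon>\<close> follows by faithfulness and is not part of the locale.
\<close>

locale pfc_adjunction = R: pfc_fctr P Q R + L: pfc_fctr Q P L
  for P :: "('o, 'm, 'a) pfc" and Q :: "('p, 'n, 'b) pfc"
    and R :: "('o, 'm, 'a, 'p, 'n, 'b) pfc_fun" and L :: "('p, 'n, 'b, 'o, 'm, 'a) pfc_fun" +
  fixes \<eta> :: "'p \<Rightarrow> 'n" and \<epsilon> :: "'o \<Rightarrow> 'm"
  assumes unit_hom: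
      "d \<in> Obj (Cat Q) \<Longrightarrow> \<eta> d \<in> homset (Cat Q) d (fob (Fun R) (fob (Fun L) d))"
    and counit_hom:
      "c \<in> Obj (Cat P) \<Longrightarrow> \<epsilon> c \<in> homset (Cat P) (fob (Fun L) (fob (Fun R) c)) c"
    and far_counit:
      "c \<in> Obj (Cat P) \<Longrightarrow> far (Opens P) (\<epsilon> c) = Nat R c \<bullet>\<^sub>f Nat L (fob (Fun R) c)"
    and far_unit:
      "d \<in> Obj (Cat Q) \<Longrightarrow> Nat L d \<bullet>\<^sub>f Nat R (fob (Fun L) d) \<bullet>\<^sub>f far (Opens Q) (\<eta> d)
        = frm_id (fob (Opens Q) d)"
begin

lemma undm_counit:
  assumes c: "c \<in> Obj (Cat P)" and x: "x \<in> und P (fob (Fun L) (fob (Fun R) c))"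
  shows "undm P (\<epsilon> c) x = fn (Nat R c) (fn (Nat L (fob (Fun R) c)) x)"
  using frm_comp_apply[OF frm_iso_hom[OF L.Nat_iso[OF R.F.fob_Obj[OF c]]]] x
  by (simp add: undm_def und_def far_counit[OF c])

lemma undm_unit:
  assumes d: "d \<in> Obj (Cat Q)" and x: "x \<in> und Q d"
  shows "fn (Nat L d) (fn (Nat R (fob (Fun L) d)) (undm Q (\<eta> d) x)) = x"
proof -
  let ?Ld = "fob (Fun L) d"
  have u: "undm Q (\<eta> d) x \<in> und Q (fob (Fun R) ?Ld)"
    by (rule R.target.undm_closed[OF unit_hom[OF d] x])
  have "fn (Nat L d \<bullet>\<^sub>f Nat R ?Ld \<bullet>\<^sub>f far (Opens Q) (\<eta> d)) x
    = fn (Nat L d \<bullet>\<^sub>f Nat R ?Ld) (undm Q (\<eta> d) x)"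
    using frm_comp_apply[OF R.target.far_frm_hom[OF unit_hom[OF d]]] x
    by (simp add: und_def undm_def)
  also have "\<dots> = fn (Nat L d) (fn (Nat R ?Ld) (undm Q (\<eta> d) x))"
    using frm_comp_apply[OF frm_iso_hom[OF R.Nat_iso[OF L.F.fob_Obj[OF d]]]] u
    by (simp add: und_def)
  finally show ?thesis using x by (simp add: far_unit[OF d] frm_id_def und_def)
qed

text \<open>Since \<open>\<lambda>\<close> is bijective, its right inverse \<open>\<alpha> \<circ> \<O> \<eta>\<close> is also a left inverse.\<close>

lemma undm_unit':
  assumes d: "d \<in> Obj (Cat Q)" and y: "y \<in> und P (fob (Fun L) d)"
  shows "fn (Nat R (fob (Fun L) d)) (undm Q (\<eta> d) (fn (Nat L d) y)) = y"
proof (rule inj_onD[OF L.Nat_inj[OF d] undm_unit[OF d L.Nat_closed[OF d y]] _ y])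
  show "fn (Nat R (fob (Fun L) d)) (undm Q (\<eta> d) (fn (Nat L d) y)) \<in> und P (fob (Fun L) d)"
    by (intro R.Nat_closed L.F.fob_Obj d R.target.undm_closed[OF unit_hom[OF d]]
        L.Nat_closed y)
qed

text \<open>
  The transposes are \<open>\<epsilon> \<circ> L p\<close> of \<open>p : d \<rightarrow> R c\<close> and \<open>R q \<circ> \<eta>\<close> of \<open>q : L d \<rightarrow> c\<close>. The function
  \<open>h\<close> need not underlie a frame homomorphism, so the equivalence is one between arbitrary
  functions.
\<close>

lemma lifts_transpose:
  assumes c: "c \<in> Obj (Cat P)" and d: "d \<in> Obj (Cat Q)"
    and h: "h \<in> und Q d \<rightarrow>\<^sub>E und Q (fob (Fun R) c)"
  shows "lifts (Cat Q) (undm Q) d (fob (Fun R) c) h \<longleftrightarrow>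
    lifts (Cat P) (undm P) (fob (Fun L) d) c
      (restrict (fn (Nat R c) \<circ> h \<circ> fn (Nat L d)) (und P (fob (Fun L) d)))"
    (is "?l \<longleftrightarrow> lifts _ _ _ _ ?h'")
proof
  let ?Ld = "fob (Fun L) d" and ?Rc = "fob (Fun R) c"
  note Ld = L.F.fob_Obj[OF d] and Rc = R.F.fob_Obj[OF c]
  {
    assume ?l
    then obtain p where p: "p \<in> homset (Cat Q) d ?Rc" "h = undm Q p" by (auto simp: lifts_def)
    note Lp = L.F.far_hom[OF p(1)]
    have q: "\<epsilon> c \<cdot>\<^bsub>Cat P\<^esub> far (Fun L) p \<in> homset (Cat P) ?Ld c"
      by (rule R.source.source.Comp_hom[OF Lp counit_hom[OF c]])
    have "undm P (\<epsilon> c \<cdot>\<^bsub>Cat P\<^esub> far (Fun L) p) x = fn (Nat R c) (h (fn (Nat L d) x))"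
      if x: "x \<in> und P ?Ld" for x
      using R.source.undm_comp[OF Lp counit_hom[OF c] x]
        undm_counit[OF c R.source.undm_closed[OF Lp x]] L.Nat_natural[OF p(1) x]
      by (simp add: p(2))
    then have "?h' = undm P (\<epsilon> c \<cdot>\<^bsub>Cat P\<^esub> far (Fun L) p)"
      using R.source.undm_extensional[OF q] by (intro extensionalityI[of _ "und P ?Ld"]) auto
    then show "lifts (Cat P) (undm P) ?Ld c ?h'" using q by (auto simp: lifts_def)
  next
    assume "lifts (Cat P) (undm P) ?Ld c ?h'"
    then obtain q where q: "q \<in> homset (Cat P) ?Ld c" "?h' = undm P q" by (auto simp: lifts_def)
    note Rq = R.F.far_hom[OF q(1)]
    have p: "far (Fun R) q \<cdot>\<^bsub>Cat Q\<^esub> \<eta> d \<in> homset (Cat Q) d ?Rc"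
      by (rule R.target.source.Comp_hom[OF unit_hom[OF d] Rq])
    have "undm Q (far (Fun R) q \<cdot>\<^bsub>Cat Q\<^esub> \<eta> d) x = h x" if x: "x \<in> und Q d" for x
    proof (rule inj_onD[OF R.Nat_inj[OF c]])
      note u = R.target.undm_closed[OF unit_hom[OF d] x]
      show "undm Q (far (Fun R) q \<cdot>\<^bsub>Cat Q\<^esub> \<eta> d) x \<in> und Q ?Rc"
        by (rule R.target.undm_closed[OF p x])
      show "h x \<in> und Q ?Rc" using h x by blast
      have "fn (Nat R c) (undm Q (far (Fun R) q \<cdot>\<^bsub>Cat Q\<^esub> \<eta> d) x)
        = undm P q (fn (Nat R ?Ld) (undm Q (\<eta> d) x))"
        using R.target.undm_comp[OF unit_hom[OF d] Rq x] R.Nat_natural[OF q(1) u] by simp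
      also have "\<dots> = fn (Nat R c) (h x)"
        using R.Nat_closed[OF Ld u] undm_unit[OF d x] by (simp add: q(2)[symmetric])
      finally show "fn (Nat R c) (undm Q (far (Fun R) q \<cdot>\<^bsub>Cat Q\<^esub> \<eta> d) x) = fn (Nat R c) (h x)" .
    qed
    then have "h = undm Q (far (Fun R) q \<cdot>\<^bsub>Cat Q\<^esub> \<eta> d)"
      using PiE_ext[OF h R.target.undm_PiE[OF p]] by simp
    then show ?l using p by (auto simp: lifts_def)
  }
qed

text \<open>
  Transposition carries \<open>\<alpha>\<inverse> \<circ> \<iota>\<inverse> \<circ> \<chi>\<^sub>x \<circ> \<theta> \<circ> \<alpha> \<circ> h\<close> to \<open>\<iota>\<inverse> \<circ> \<chi>\<^sub>x \<circ> \<theta> \<circ> (\<alpha> \<circ> h \<circ> \<lambda>)\<close>, whose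
  lifting for all \<open>x\<close> is equivalent to that of \<open>\<alpha> \<circ> h \<circ> \<lambda>\<close>, the transpose of \<open>h\<close>.
\<close>

lemma cartesian_lift_right_adjoint:
  assumes "is_Omega P X W \<theta>"
  shows "cartesian_lift (Cat Q) (und Q) (undm Q) (sierpinski_maps X) (fob (Fun R) (Two P))
    (topspace X) (\<lambda>x. inv_fn (Nat R (Two P)) \<circ> inv_fn (Iota P) \<circ> chi x)
    (fob (Fun R) W) (\<theta> \<circ> fn (Nat R W))"
proof -
  have W: "W \<in> Obj (Cat P)" and \<theta>: "bij_betw \<theta> (und P W) (sierpinski_maps X)"
    and lift: "\<And>a h. \<lbrakk>a \<in> Obj (Cat P); h \<in> und P a \<rightarrow>\<^sub>E und P W\<rbrakk> \<Longrightarrow>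
      lifts (Cat P) (undm P) a W h \<longleftrightarrow> (\<forall>x\<in>topspace X. lifts (Cat P) (undm P) a (Two P)
        (restrict ((inv_fn (Iota P) \<circ> chi x) \<circ> \<theta> \<circ> h) (und P a)))"
    using assms by (auto simp: is_Omega_def cartesian_lift_def)
  note T = R.source.Two_Obj
  have "lifts (Cat Q) (undm Q) d (fob (Fun R) W) h \<longleftrightarrow>
    (\<forall>x\<in>topspace X. lifts (Cat Q) (undm Q) d (fob (Fun R) (Two P))
      (restrict ((inv_fn (Nat R (Two P)) \<circ> inv_fn (Iota P) \<circ> chi x) \<circ> (\<theta> \<circ> fn (Nat R W)) \<circ> h)
        (und Q d)))"
    if d: "d \<in> Obj (Cat Q)" and h: "h \<in> und Q d \<rightarrow>\<^sub>E und Q (fob (Fun R) W)" for d h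
  proof -
    let ?Ld = "fob (Fun L) d"
    let ?h = "restrict (fn (Nat R W) \<circ> h \<circ> fn (Nat L d)) (und P ?Ld)"
    have hL: "?h \<in> und P ?Ld \<rightarrow>\<^sub>E und P W"
      using L.Nat_closed[OF d] R.Nat_closed[OF W] h by (auto simp: PiE_iff Pi_iff)
    have "lifts (Cat P) (undm P) ?Ld (Two P)
        (restrict ((inv_fn (Iota P) \<circ> chi x) \<circ> \<theta> \<circ> ?h) (und P ?Ld)) \<longleftrightarrow>
      lifts (Cat Q) (undm Q) d (fob (Fun R) (Two P))
        (restrict ((inv_fn (Nat R (Two P)) \<circ> inv_fn (Iota P) \<circ> chi x) \<circ> (\<theta> \<circ> fn (Nat R W)) \<circ> h)
          (und Q d))" (is "_ \<longleftrightarrow> lifts _ _ _ _ ?k") for x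
    proof -
      have i: "inv_fn (Iota P) v \<in> und P (Two P)" for v
        using inv_fn_closed[OF R.source.Iota_iso] by (simp add: und_def)
      have "?k \<in> und Q d \<rightarrow>\<^sub>E und Q (fob (Fun R) (Two P))"
        using inv_fn_closed[OF R.Nat_iso[OF T]] i by (auto simp: und_def)
      note tr = lifts_transpose[OF T d this]
      have "restrict (fn (Nat R (Two P)) \<circ> ?k \<circ> fn (Nat L d)) (und P ?Ld)
        = restrict ((inv_fn (Iota P) \<circ> chi x) \<circ> \<theta> \<circ> ?h) (und P ?Ld)"
        using L.Nat_closed[OF d] fn_inv_fn[OF R.Nat_iso[OF T]] i
        by (intro restrict_ext) (simp add: und_def)
      then show ?thesis using tr by simp
    qed
    then show ?thesis
      unfolding lifts_transpose[OF W d h] lift[OF L.F.fob_Obj[OF d] hL] by blast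
  qed
  moreover have "bij_betw (\<theta> \<circ> fn (Nat R W)) (und Q (fob (Fun R) W)) (sierpinski_maps X)"
    by (rule bij_betw_trans[OF R.Nat_bij[OF W] \<theta>])
  ultimately show ?thesis
    using R.F.fob_Obj[OF W] by (simp add: cartesian_lift_def)
qed

lemma M3_right_adjoint: "M3 TYPE('x) P Q R"
  unfolding M3_def using cartesian_lift_right_adjoint by blast

lemma is_Omega_right_adjoint:
  fixes X :: "'x topology"
  assumes "is_Omega P X W \<theta>"
  shows "is_Omega Q X (fob (Fun R) W) (\<theta> \<circ> fn (Nat R W))"
proof -
  note cl = cartesian_lift_right_adjoint[OF assms]
  have "lifts (Cat Q) (undm Q) d (fob (Fun R) (Two P))
      (restrict ((inv_fn (Nat R (Two P)) \<circ> inv_fn (Iota P) \<circ> chi x) \<circ> t \<circ> h) (und Q d)) \<longleftrightarrow>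
    lifts (Cat Q) (undm Q) d (Two Q)
      (restrict ((inv_fn (Iota Q) \<circ> chi x) \<circ> t \<circ> h) (und Q d))"
    (is "lifts _ _ _ _ ?k \<longleftrightarrow> _") for d and x :: 'x and t :: "'b \<Rightarrow> 'x \<Rightarrow> bool" and h
  proof -
    have "?k \<in> und Q d \<rightarrow>\<^sub>E und Q (fob (Fun R) (Two P))"
      using inv_fn_closed[OF R.Nat_iso[OF R.source.Two_Obj]] inv_fn_closed[OF R.source.Iota_iso]
      by (auto simp: und_def)
    moreover have "restrict (undm Q (Cmp R) \<circ> ?k) (und Q d)
      = restrict ((inv_fn (Iota Q) \<circ> chi x) \<circ> t \<circ> h) (und Q d)"
      by (intro restrict_ext) (simp add: R.inv_Iota_target)
    ultimately show ?thesis
      using R.target.lifts_comp_iso[OF R.Cmp_iso] by simp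
  qed
  then show ?thesis
    using cl unfolding is_Omega_def cartesian_lift_def by simp
qed

lemma in_Top_right_adjoint: "in_Top P X \<Longrightarrow> in_Top Q X"
  using is_Omega_right_adjoint unfolding in_Top_def by blast

section \<open>Spaces of points\<close>

text \<open>
  The map \<open>g \<mapsto> j \<circ> L g\<close> has underlying frame homomorphism \<open>\<iota> \<circ> \<O> g \<circ> \<lambda>\<close>, so it matches the
  opens of \<open>pt (L d)\<close> and \<open>pt d\<close> along the bijection \<open>\<lambda>\<close>. Its inverse sends \<open>f\<close> to
  \<open>i \<circ> R f \<circ> \<eta>\<close>.
\<close>

lemma pt_homeomorphic:
  assumes d: "d \<in> Obj (Cat Q)"
  shows "pt Q d homeomorphic_space pt P (fob (Fun L) d)"
proof -
  let ?Ld = "fob (Fun L) d"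
  define \<phi> where "\<phi> g = Cmp L \<cdot>\<^bsub>Cat P\<^esub> far (Fun L) g" for g
  note Ld = L.F.fob_Obj[OF d]
  note tsQ = topspace_pt[OF R.target.pfc_category d]
  note tsP = topspace_pt[OF R.source.pfc_category Ld]
  have \<phi>: "\<phi> g \<in> homset (Cat P) ?Ld (Two P)" if "g \<in> homset (Cat Q) d (Two Q)" for g
    unfolding \<phi>_def by (rule R.source.source.Comp_hom[OF L.F.far_hom[OF that] L.Cmp_hom])
  have \<phi>_und: "fn (Iota P) (undm P (\<phi> g) y) = fn (Iota Q) (undm Q g (fn (Nat L d) y))"
    if g: "g \<in> homset (Cat Q) d (Two Q)" and y: "y \<in> und P ?Ld" for g y
  proof -
    note Lg = L.F.far_hom[OF g]
    show ?thesis
      unfolding \<phi>_def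
      using R.source.undm_comp[OF Lg L.Cmp_hom y] L.Iota_Cmp[OF R.source.undm_closed[OF Lg y]]
        L.Nat_natural[OF g y] by simp
  qed
  have inj: "inj_on \<phi> (homset (Cat Q) d (Two Q))"
  proof (rule inj_onI)
    fix g g' assume g: "g \<in> homset (Cat Q) d (Two Q)" and g': "g' \<in> homset (Cat Q) d (Two Q)"
      and eq: "\<phi> g = \<phi> g'"
    show "g = g'"
    proof (rule R.target.undm_faithful[OF g g'])
      fix x assume x: "x \<in> und Q d"
      then obtain y where y: "y \<in> und P ?Ld" "x = fn (Nat L d) y"
        using L.Nat_bij[OF d] by (auto simp: bij_betw_def)
      show "undm Q g x = undm Q g' x"
        using \<phi>_und[OF g y(1)] \<phi>_und[OF g' y(1)] eq y(2)
          inj_onD[OF R.target.Iota_inj] R.target.undm_closed[OF g x]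
          R.target.undm_closed[OF g' x] by simp
    qed
  qed
  have surj: "f \<in> \<phi> ` homset (Cat Q) d (Two Q)" if f: "f \<in> homset (Cat P) ?Ld (Two P)" for f
  proof -
    define r where "r = far (Fun R) f \<cdot>\<^bsub>Cat Q\<^esub> \<eta> d"
    define g where "g = Cmp R \<cdot>\<^bsub>Cat Q\<^esub> r"
    note Rf = R.F.far_hom[OF f]
    have r: "r \<in> homset (Cat Q) d (fob (Fun R) (Two P))"
      unfolding r_def by (rule R.target.source.Comp_hom[OF unit_hom[OF d] Rf])
    have g: "g \<in> homset (Cat Q) d (Two Q)"
      unfolding g_def by (rule R.target.source.Comp_hom[OF r R.Cmp_hom])
    have "f = \<phi> g"
    proof (rule R.source.undm_faithful[OF f \<phi>[OF g]])
      fix y assume y: "y \<in> und P ?Ld"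
      define x where "x = fn (Nat L d) y"
      have x: "x \<in> und Q d" unfolding x_def by (rule L.Nat_closed[OF d y])
      have "fn (Iota P) (undm P (\<phi> g) y) = fn (Iota Q) (undm Q g x)"
        unfolding x_def by (rule \<phi>_und[OF g y])
      also have "\<dots> = fn (Iota P) (fn (Nat R (Two P)) (undm Q r x))"
        using R.target.undm_comp[OF r R.Cmp_hom x] R.Iota_Cmp[OF R.target.undm_closed[OF r x]]
        by (simp add: g_def)
      also have "\<dots> = fn (Iota P) (undm P f (fn (Nat R ?Ld) (undm Q (\<eta> d) x)))"
        using R.target.undm_comp[OF unit_hom[OF d] Rf x]
          R.Nat_natural[OF f R.target.undm_closed[OF unit_hom[OF d] x]] by (simp add: r_def)
      also have "\<dots> = fn (Iota P) (undm P f y)"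
        unfolding x_def undm_unit'[OF d y] ..
      finally show "undm P f y = undm P (\<phi> g) y"
        using inj_onD[OF R.source.Iota_inj] R.source.undm_closed[OF f y]
          R.source.undm_closed[OF \<phi>[OF g] y] by simp
    qed
    then show ?thesis using g by blast
  qed
  have img: "\<phi> ` homset (Cat Q) d (Two Q) = homset (Cat P) ?Ld (Two P)"
    using \<phi> surj by blast
  have pre: "{g \<in> homset (Cat Q) d (Two Q). \<phi> g \<in> pt_open P ?Ld y} = pt_open Q d (fn (Nat L d) y)"
    if "y \<in> und P ?Ld" for y
    using \<phi> \<phi>_und that by (auto simp: pt_open_def)
  have "homeomorphic_map (pt Q d) (pt P ?Ld) \<phi>"
    unfolding homeomorphic_map_def quotient_map_def tsQ tsP
  proof (intro conjI allI impI)
    fix U assume U: "U \<subseteq> homset (Cat P) ?Ld (Two P)"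
    let ?V = "{g \<in> homset (Cat Q) d (Two Q). \<phi> g \<in> U}"
    have imgV: "\<phi> ` ?V = U" using U unfolding img[symmetric] by auto
    show "openin (pt Q d) ?V \<longleftrightarrow> openin (pt P ?Ld) U"
      unfolding openin_pt[OF R.target.pfc_category d] openin_pt[OF R.source.pfc_category Ld]
    proof
      assume "\<exists>x\<in>und Q d. ?V = pt_open Q d x"
      then obtain x where x: "x \<in> und Q d" "?V = pt_open Q d x" by blast
      obtain y where "y \<in> und P ?Ld" "x = fn (Nat L d) y"
        using L.Nat_bij[OF d] x(1) by (auto simp: bij_betw_def)
      with x(2) have y: "y \<in> und P ?Ld" "?V = pt_open Q d (fn (Nat L d) y)" by simp_all
      have "U = \<phi> ` {g \<in> homset (Cat Q) d (Two Q). \<phi> g \<in> pt_open P ?Ld y}"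
        unfolding pre[OF y(1)] y(2)[symmetric] imgV ..
      also have "\<dots> = pt_open P ?Ld y"
        using img by (auto simp: pt_open_def)
      finally show "\<exists>a\<in>und P ?Ld. U = pt_open P ?Ld a" using y(1) by blast
    next
      assume "\<exists>a\<in>und P ?Ld. U = pt_open P ?Ld a"
      then show "\<exists>x\<in>und Q d. ?V = pt_open Q d x"
        using pre L.Nat_closed[OF d] by blast
    qed
  qed (use img inj in auto)
  then show ?thesis
    by (rule homeomorphic_map_imp_homeomorphic_space)
qed

end

lemma bij_betw_sierpinski_maps:
  assumes "homeomorphic_maps X Y \<phi> \<psi>"
  shows "bij_betw (\<lambda>g. restrict (g \<circ> \<phi>) (topspace X)) (sierpinski_maps Y) (sierpinski_maps X)"
proof (rule bij_betw_byWitness[where f' = "\<lambda>g. restrict (g \<circ> \<psi>) (topspace Y)"])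
  have \<phi>: "continuous_map X Y \<phi>" and \<psi>: "continuous_map Y X \<psi>"
    and \<psi>\<phi>: "\<And>x. x \<in> topspace X \<Longrightarrow> \<psi> (\<phi> x) = x" and \<phi>\<psi>: "\<And>y. y \<in> topspace Y \<Longrightarrow> \<phi> (\<psi> y) = y"
    using assms by (auto simp: homeomorphic_maps_def)
  have \<phi>t: "\<phi> x \<in> topspace Y" if "x \<in> topspace X" for x
    using continuous_map_image_subset_topspace[OF \<phi>] that by blast
  have \<psi>t: "\<psi> y \<in> topspace X" if "y \<in> topspace Y" for y
    using continuous_map_image_subset_topspace[OF \<psi>] that by blast
  have ext: "g \<in> sierpinski_maps Z \<Longrightarrow> g \<in> extensional (topspace Z)" for g and Z :: "'z topology"
    by (simp add: sierpinski_maps_def)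
  show "\<forall>g\<in>sierpinski_maps Y.
      restrict (restrict (g \<circ> \<phi>) (topspace X) \<circ> \<psi>) (topspace Y) = g"
    using ext \<phi>\<psi> \<psi>t by (intro ballI extensionalityI[of _ "topspace Y"]) auto
  show "\<forall>g\<in>sierpinski_maps X.
      restrict (restrict (g \<circ> \<psi>) (topspace Y) \<circ> \<phi>) (topspace X) = g"
    using ext \<psi>\<phi> \<phi>t by (intro ballI extensionalityI[of _ "topspace X"]) auto
  show "(\<lambda>g. restrict (g \<circ> \<phi>) (topspace X)) ` sierpinski_maps Y \<subseteq> sierpinski_maps X"
    using continuous_map_compose[OF \<phi>]
    by (auto simp: sierpinski_maps_def restrict_continuous_map)
  show "(\<lambda>g. restrict (g \<circ> \<psi>) (topspace Y)) ` sierpinski_maps X \<subseteq> sierpinski_maps Y"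
    using continuous_map_compose[OF \<psi>]
    by (auto simp: sierpinski_maps_def restrict_continuous_map)
qed

lemma in_Top_homeomorphic:
  fixes P :: "('o, 'm, 'a) pfc"
  assumes XY: "X homeomorphic_space Y" and Y: "in_Top P Y"
  shows "in_Top P X"
proof -
  obtain \<phi> \<psi> where hom: "homeomorphic_maps X Y \<phi> \<psi>"
    using XY by (auto simp: homeomorphic_space_def)
  obtain W \<theta> where om: "is_Omega P Y W \<theta>" using Y by (auto simp: in_Top_def)
  define \<theta>' where "\<theta>' = (\<lambda>g. restrict (g \<circ> \<phi>) (topspace X)) \<circ> \<theta>"
  have img: "topspace Y = \<phi> ` topspace X"
    using homeomorphic_imp_surjective_map hom homeomorphic_map_maps by metis
  have "bij_betw \<theta>' (und P W) (sierpinski_maps X)"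
    using om unfolding \<theta>'_def is_Omega_def cartesian_lift_def
    by (blast intro: bij_betw_trans bij_betw_sierpinski_maps[OF hom])
  moreover have "(inv_fn (Iota P) \<circ> chi x) \<circ> \<theta>' \<circ> h = (inv_fn (Iota P) \<circ> chi (\<phi> x)) \<circ> \<theta> \<circ> h"
    if "x \<in> topspace X" for x and h :: "'a \<Rightarrow> 'a"
    using that by (simp add: \<theta>'_def chi_def fun_eq_iff)
  ultimately have "is_Omega P X W \<theta>'"
    using om unfolding is_Omega_def cartesian_lift_def img by simp
  then show ?thesis by (auto simp: in_Top_def)
qed

section \<open>SFC-categories along right adjoints\<close>

theorem theorem2p19:
  fixes P :: "('o, 'm, 'a) pfc"
    and Q :: "('p, 'n, 'b) pfc"
    and R :: "('o, 'm, 'a, 'p, 'n, 'b) pfc_fun"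
  assumes "pfc_category P" and "pfc_category Q"
    and "pfc_functor P Q R"
    and "right_pfc_adjoint P Q R"
    and "sfc_category P"
  shows "sfc_category Q \<and> sfc_functor TYPE('x) P Q R"
proof -
  obtain L :: "('p, 'n, 'b, 'o, 'm, 'a) pfc_fun" and \<eta> \<epsilon> where
    L: "pfc_functor Q P L" and
    \<eta>: "nat_trans (Cat Q) (Cat Q) id_functor (Fun R \<circ>\<^sub>F Fun L) \<eta>" and
    \<epsilon>: "nat_trans (Cat P) (Cat P) (Fun L \<circ>\<^sub>F Fun R) id_functor \<epsilon>" and
    eqs: "\<forall>c\<in>Obj (Cat P). far (Opens P) (\<epsilon> c) = Nat R c \<bullet>\<^sub>f Nat L (fob (Fun R) c)"
      "\<forall>d\<in>Obj (Cat Q). Nat L d \<bullet>\<^sub>f Nat R (fob (Fun L) d) \<bullet>\<^sub>f far (Opens Q) (\<eta> d)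
        = frm_id (fob (Opens Q) d)"
    using assms(4) unfolding right_pfc_adjoint_def by blast
  interpret pfc_adjunction P Q R L \<eta> \<epsilon>
    using assms(1-3) L \<eta> \<epsilon> eqs
    by unfold_locales (auto simp: nat_trans_def id_functor_def comp_functor_def)
  have "in_Top Q (pt Q d)" if d: "d \<in> Obj (Cat Q)" for d
    using assms(5) L.F.fob_Obj[OF d]
    by (intro in_Top_homeomorphic[OF pt_homeomorphic[OF d]] in_Top_right_adjoint)
      (simp add: sfc_category_def)
  moreover have "in_Top Q \<S>"
    using assms(5) by (intro in_Top_right_adjoint) (simp add: sfc_category_def)
  ultimately have "sfc_category Q"
    using assms(2) by (simp add: sfc_category_def)
  then show ?thesis
    using assms(3,5) M3_right_adjoint by (simp add: sfc_functor_def)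
qed

end
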